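(* Fix $n$, and for each integer $d$ with $2\le d\le n-1$ let $$G_d=G\Big[a\cdot 1,\ \Big\lfloor\tfrac{n-d+1}{2}\Big\rfloor,\ \Big\lceil\tfrac{n-d+1}{2}\Big\rceil,\ b\cdot 1\Big],$$ where $a+b=d-1$ and $(a,b)=(0,1),(1,1),(1,2),(2,2),(2,3)$ for $d=2,3,4,5,6$ respectively, and $a\ge 3$, $b\ge 3$ for $d\ge 7$. Then, for $2\le d\le n-1$, $\prod_1(G_d)$ is a decreasing function of $d$, and likewise $\prod_2(G_d)$ is a decreasing function of $d$.
   Context: All graphs are finite, simple, undirected and connected; $d(u)$ denotes the degree of a vertex $u$. The first and second multiplicative Zagreb indices of a graph $G$ are $\prod_1(G)=\prod_{u\in V(G)}d(u)^2$ and $\prod_2(G)=\prod_{uv\in E(G)}d(u)d(v)=\prod_{u\in V(G)}d(u)^{d(u)}$. For integers $a,b\ge 0$ with $a+b=d-1$, and positive integers $s,t$ with $s+t=n-d+1$, $G[a\cdot 1,s,t,b\cdot 1]$ denotes the $n$-vertex graph whose vertex set is partitioned into sets $V_0,V_1,\dots,V_d$ with $|V_a|=s$, $|V_{a+1}|=t$ and $|V_j|=1$ for all $j\in\{0,\dots,d\}\setminus\{a,a+1\}$, where each $V_i$ is an independent set, every vertex of $V_{i-1}$ is adjacent to every vertex of $V_i$ for $1\le i\le d$, and there are no other edges. The convention $a\le b$ is always used. *)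

theory Defs
  imports Main
begin

text \<open>A graph is a pair of a vertex set and a set of edges, an edge being the two-element
  set of its endpoints.\<close>

type_synonym 'v graph = "'v set \<times> 'v set set"

abbreviation verts :: "'v graph \<Rightarrow> 'v set" where "verts G \<equiv> fst G"
abbreviation edges :: "'v graph \<Rightarrow> 'v set set" where "edges G \<equiv> snd G"

definition simple_connected_graph :: "'v graph \<Rightarrow> bool" where
  "simple_connected_graph G \<longleftrightarrow>
     finite (verts G) \<and>
     (\<forall>e\<in>edges G. e \<subseteq> verts G \<and> card e = 2) \<and>
     (\<forall>u\<in>verts G. \<forall>v\<in>verts G. (u, v) \<in> {(x, y). {x, y} \<in> edges G}\<^sup>*)"

definition degree :: "'v graph \<Rightarrow> 'v \<Rightarrow> nat" where
  "degree G u = card {v. {u, v} \<in> edges G}"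

definition zagreb_prod1 :: "'v graph \<Rightarrow> nat" where
  "zagreb_prod1 G = (\<Prod>u\<in>verts G. (degree G u)\<^sup>2)"

text \<open>The inner product is \<open>d(u) d(v)\<close> for the edge \<open>e = uv\<close>.\<close>

definition zagreb_prod2 :: "'v graph \<Rightarrow> nat" where
  "zagreb_prod2 G = (\<Prod>e\<in>edges G. \<Prod>u\<in>e. degree G u)"

text \<open>The graph \<open>G[a \<cdot> 1, s, t, b \<cdot> 1]\<close>, with \<open>d = a + b + 1\<close>. The class \<open>V\<^sub>i\<close>
  (\<open>0 \<le> i \<le> a + b + 1\<close>) consists of the pairs \<open>(i, j)\<close> with \<open>j < class_size a s t i\<close>.\<close>

definition class_size :: "nat \<Rightarrow> nat \<Rightarrow> nat \<Rightarrow> nat \<Rightarrow> nat" where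
  "class_size a s t i = (if i = a then s else if i = a + 1 then t else 1)"

definition vertex_class :: "nat \<Rightarrow> nat \<Rightarrow> nat \<Rightarrow> nat \<Rightarrow> (nat \<times> nat) set" where
  "vertex_class a s t i = {i} \<times> {..<class_size a s t i}"

definition class_graph :: "nat \<Rightarrow> nat \<Rightarrow> nat \<Rightarrow> nat \<Rightarrow> (nat \<times> nat) graph" where
  "class_graph a s t b =
     (\<Union>i\<in>{0..a + b + 1}. vertex_class a s t i,
      {{u, v} |u v i. i \<in> {1..a + b + 1} \<and>
                      u \<in> vertex_class a s t (i - 1) \<and> v \<in> vertex_class a s t i})"

lemma card_verts_class_graph: "card (verts (class_graph a s t b)) = a + b + s + t"
proof -
  have "card (verts (class_graph a s t b)) = (\<Sum>i\<in>{0..a + b + 1}. card (vertex_class a s t i))"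
    unfolding class_graph_def fst_conv
    by (rule card_UN_disjoint) (auto simp: vertex_class_def)
  also have "\<dots> = (\<Sum>i\<in>{0..a + b + 1}. class_size a s t i)"
    by (simp add: vertex_class_def)
  also have "{0..a + b + 1} = {..<a} \<union> {a, a + 1} \<union> {a + 2..a + b + 1}"
    by auto
  also have "(\<Sum>i\<in>\<dots>. class_size a s t i) =
      (\<Sum>i\<in>{..<a}. class_size a s t i) + (\<Sum>i\<in>{a, a + 1}. class_size a s t i)
      + (\<Sum>i\<in>{a + 2..a + b + 1}. class_size a s t i)"
    by (subst sum.union_disjoint, simp, simp, force, subst sum.union_disjoint) auto
  also have "\<dots> = a + (s + t) + b"
    by (simp add: class_size_def)
  finally show ?thesis by simp
qed

lemma simple_connected_class_graph:
  assumes "s > 0" "t > 0"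
  shows "simple_connected_graph (class_graph a s t b)"
proof -
  let ?G = "class_graph a s t b"
  let ?R = "{(x, y). {x, y} \<in> edges ?G}"
  have pos: "0 < class_size a s t i" for i
    using assms by (simp add: class_size_def)
  have edge: "{(i, j), (Suc i, k)} \<in> edges ?G"
    if "i \<le> a + b" "j < class_size a s t i" "k < class_size a s t (Suc i)" for i j k
  proof -
    have "Suc i \<in> {1..a + b + 1}" "(i, j) \<in> vertex_class a s t (Suc i - 1)"
      "(Suc i, k) \<in> vertex_class a s t (Suc i)"
      using that by (auto simp: vertex_class_def)
    then show ?thesis unfolding class_graph_def snd_conv by blast
  qed
  have reach: "((i, j), (0, 0)) \<in> ?R\<^sup>*"
    if "i \<le> a + b + 1" "j < class_size a s t i" "i = 0 \<Longrightarrow> a = 0 \<Longrightarrow> j = 0" for i j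
    using that
  proof (induction i arbitrary: j)
    case 0
    then show ?case by (cases "a = 0") (auto simp: class_size_def split: if_splits)
  next
    case (Suc i)
    have "((Suc i, j), (i, 0)) \<in> ?R"
      using edge[of i 0 j] Suc.prems pos[of i] by (simp add: insert_commute)
    moreover have "((i, 0), (0, 0)) \<in> ?R\<^sup>*"
      using Suc.IH[of 0] Suc.prems pos[of i] by auto
    ultimately show ?case by (rule converse_rtrancl_into_rtrancl)
  qed
  have reach0: "((0, j), (0, 0)) \<in> ?R\<^sup>*" if "j < class_size a s t 0" for j
  proof -
    have "((0, j), (1, 0)) \<in> ?R"
      using edge[of 0 j 0] that pos[of 1] by simp
    moreover have "((1, 0), (0, 0)) \<in> ?R\<^sup>*"
      using reach[of 1 0] pos[of 1] by auto
    ultimately show ?thesis by (rule converse_rtrancl_into_rtrancl)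
  qed
  have "(u, (0, 0)) \<in> ?R\<^sup>*" if "u \<in> verts ?G" for u
    using that reach[of "fst u" "snd u"] reach0[of "snd u"]
    by (cases "fst u = 0") (auto simp: class_graph_def vertex_class_def)
  moreover have "sym (?R\<^sup>*)"
    by (rule sym_rtrancl) (auto simp: sym_def insert_commute)
  ultimately have "(u, v) \<in> ?R\<^sup>*" if "u \<in> verts ?G" "v \<in> verts ?G" for u v
    using that by (meson rtrancl_trans symE)
  moreover have "finite (verts ?G)"
    by (simp add: class_graph_def vertex_class_def)
  moreover have "e \<subseteq> verts ?G \<and> card e = 2" if "e \<in> edges ?G" for e
  proof -
    obtain u v i where e: "e = {u, v}" and i: "i \<in> {1..a + b + 1}"
      and u: "u \<in> vertex_class a s t (i - 1)" and v: "v \<in> vertex_class a s t i"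
      using \<open>e \<in> edges ?G\<close> unfolding class_graph_def by auto
    have "u \<in> verts ?G" "v \<in> verts ?G"
      using i u v by (force simp: class_graph_def)+
    moreover have "u \<noteq> v"
      using i u v by (auto simp: vertex_class_def)
    ultimately show ?thesis using e by simp
  qed
  ultimately show ?thesis
    unfolding simple_connected_graph_def by blast
qed

lemma zagreb_prod2_eq_prod_verts:
  assumes "simple_connected_graph G"
  shows "zagreb_prod2 G = (\<Prod>u\<in>verts G. degree G u ^ degree G u)"
proof -
  have fin: "finite (verts G)" and ed: "\<And>e. e \<in> edges G \<Longrightarrow> e \<subseteq> verts G \<and> card e = 2"
    using assms by (auto simp: simple_connected_graph_def)
  have finE: "finite (edges G)"
    by (rule finite_subset[of _ "Pow (verts G)"]) (use ed fin in auto)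
  have deg: "card {e \<in> edges G. u \<in> e} = degree G u" for u
  proof -
    have "bij_betw (\<lambda>v. {u, v}) {v. {u, v} \<in> edges G} {e \<in> edges G. u \<in> e}"
      unfolding bij_betw_def
    proof
      show "inj_on (\<lambda>v. {u, v}) {v. {u, v} \<in> edges G}"
        by (auto simp: inj_on_def doubleton_eq_iff)
      show "(\<lambda>v. {u, v}) ` {v. {u, v} \<in> edges G} = {e \<in> edges G. u \<in> e}"
      proof (intro equalityI subsetI)
        fix e assume e: "e \<in> {e \<in> edges G. u \<in> e}"
        then have "card e = 2" using ed by blast
        then obtain x y where "e = {x, y}" unfolding card_2_iff by blast
        then show "e \<in> (\<lambda>v. {u, v}) ` {v. {u, v} \<in> edges G}"
        proof (cases "u = x")
          case True
          then show ?thesis using e \<open>e = {x, y}\<close> by blast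
        next
          case False
          then have "e = {u, x}" using e \<open>e = {x, y}\<close> by blast
          then show ?thesis using e by blast
        qed
      qed auto
    qed
    from bij_betw_same_card[OF this] show ?thesis by (simp add: degree_def)
  qed
  have "zagreb_prod2 G = (\<Prod>e\<in>edges G. \<Prod>u\<in>{u \<in> verts G. u \<in> e}. degree G u)"
    unfolding zagreb_prod2_def
  proof (rule prod.cong[OF refl])
    fix e assume "e \<in> edges G"
    then have "{u \<in> verts G. u \<in> e} = e" using ed[of e] by blast
    then show "(\<Prod>u\<in>e. degree G u) = (\<Prod>u\<in>{u \<in> verts G. u \<in> e}. degree G u)" by simp
  qed
  also have "\<dots> = (\<Prod>u\<in>verts G. \<Prod>e\<in>{e \<in> edges G. u \<in> e}. degree G u)"
    by (rule prod.swap_restrict[OF finE fin])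
  finally show ?thesis by (simp add: deg)
qed

end

theory Submission
  imports Defs
begin

text \<open>Both indices are products \<open>\<Prod>u. f (d(u))\<close> with \<open>f 1 = 1\<close> and \<open>f\<close> strictly increasing on the
  positive integers: \<open>f x = x\<^sup>2\<close> for the first one, \<open>f x = x ^ x\<close> for the second one. These two
  properties of \<open>f\<close> suffice. When \<open>d\<close> grows by one, the two big classes change from sizes
  \<open>(s, t)\<close> to \<open>(t - 1, s)\<close>, where \<open>t \<in> {s, s + 1}\<close>; writing both products as explicit powers of
  \<open>f 2\<close> and of three consecutive values of \<open>f\<close>, common factors cancel, and what remains is an
  inequality between powers that follows from monotonicity.\<close>

section \<open>Degrees in the class graph and the resulting product formula\<close>

definition degree_weight :: "(nat \<Rightarrow> nat) \<Rightarrow> 'v graph \<Rightarrow> nat" where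
  "degree_weight f G = (\<Prod>u\<in>verts G. f (degree G u))"

text \<open>The neighbours of a vertex fill exactly the classes before and after its own, and these
  are disjoint. Both ends need a guard: at \<open>i = 0\<close> truncated subtraction would name
  class 0 itself, and beyond the last class \<open>class_size\<close> still yields a positive
  value.\<close>

lemma degree_class_graph:
  assumes "i \<le> a + b + 1" "j < class_size a s t i"
  shows "degree (class_graph a s t b) (i, j) =
    (if i = 0 then 0 else class_size a s t (i - 1)) +
    (if i = a + b + 1 then 0 else class_size a s t (i + 1))"
proof -
  let ?L = "if i = 0 then {} else vertex_class a s t (i - 1)"
  let ?R = "if i = a + b + 1 then {} else vertex_class a s t (i + 1)"
  have "{(i, j), v} \<in> edges (class_graph a s t b) \<longleftrightarrow> v \<in> ?L \<union> ?R" for v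
  proof
    assume "{(i, j), v} \<in> edges (class_graph a s t b)"
    then obtain x y k where *: "{(i, j), v} = {x, y}" "k \<in> {1..a + b + 1}"
      "x \<in> vertex_class a s t (k - 1)" "y \<in> vertex_class a s t k"
      unfolding class_graph_def snd_conv by blast
    then consider "x = (i, j)" "y = v" | "x = v" "y = (i, j)"
      by (auto simp: doubleton_eq_iff)
    then show "v \<in> ?L \<union> ?R"
    proof cases
      case 1
      then have "k = i + 1" using * by (auto simp: vertex_class_def)
      then show ?thesis using * 1 by simp
    next
      case 2
      then have "k = i" using * by (auto simp: vertex_class_def)
      then show ?thesis using * 2 by simp
    qed
  next
    assume "v \<in> ?L \<union> ?R"
    then consider "i \<noteq> 0" "v \<in> vertex_class a s t (i - 1)"
      | "i \<noteq> a + b + 1" "v \<in> vertex_class a s t (i + 1)"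
      by (auto split: if_splits)
    then show "{(i, j), v} \<in> edges (class_graph a s t b)"
    proof cases
      case 1
      have "(i, j) \<in> vertex_class a s t i" "i \<in> {1..a + b + 1}"
        using assms 1 by (auto simp: vertex_class_def)
      then show ?thesis
        unfolding class_graph_def snd_conv using 1 insert_commute[of "(i, j)" v "{}"] by blast
    next
      case 2
      have "(i, j) \<in> vertex_class a s t ((i + 1) - 1)" "i + 1 \<in> {1..a + b + 1}"
        using assms 2 by (auto simp: vertex_class_def)
      then show ?thesis
        unfolding class_graph_def snd_conv using 2 by blast
    qed
  qed
  then have "{v. {(i, j), v} \<in> edges (class_graph a s t b)} = ?L \<union> ?R" by blast
  then have "degree (class_graph a s t b) (i, j) = card (?L \<union> ?R)"
    unfolding degree_def by (rule arg_cong)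
  also have "\<dots> = card ?L + card ?R"
    by (rule card_Un_disjoint) (auto simp: vertex_class_def)
  finally show ?thesis
    by (simp add: vertex_class_def)
qed

text \<open>The contribution of a path on \<open>k\<close> vertices attached by one end to a class of size \<open>x\<close>.\<close>

fun path_weight :: "(nat \<Rightarrow> nat) \<Rightarrow> nat \<Rightarrow> nat \<Rightarrow> nat" where
  "path_weight f 0 x = 1"
| "path_weight f (Suc 0) x = f x"
| "path_weight f (Suc (Suc k)) x = f 1 * f 2 ^ k * f (x + 1)"

lemma prod_lessThan_Suc_Suc:
  fixes h :: "nat \<Rightarrow> 'a::comm_monoid_mult"
  shows "(\<Prod>i<Suc (Suc j). h i) = h 0 * (\<Prod>i<j. h (Suc i)) * h (Suc j)"
  by (subst prod.lessThan_Suc_shift) (simp add: mult.assoc)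

text \<open>The index runs from the free end to the vertex attached to the class of size
  \<open>x\<close>. Splitting off these two leaves \<open>k - 2\<close> inner vertices of degree 2;
  for \<open>k = 1\<close> one vertex plays both roles and has degree \<open>x\<close>.\<close>

lemma path_weight_left:
  "(\<Prod>i<k. f ((if i = 0 then 0 else 1) + (if i + 1 = k then x else 1))) = path_weight f k x"
proof (cases "(f, k, x)" rule: path_weight.cases)
  case (3 g j y)
  then show ?thesis by (simp add: prod_lessThan_Suc_Suc numeral_2_eq_2 del: prod.lessThan_Suc)
qed simp_all

lemma path_weight_right:
  "(\<Prod>i<k. f ((if i = 0 then x else 1) + (if i + 1 = k then 0 else 1))) = path_weight f k x"
proof (cases "(f, k, x)" rule: path_weight.cases)
  case (3 g j y)
  then show ?thesis by (simp add: prod_lessThan_Suc_Suc numeral_2_eq_2 del: prod.lessThan_Suc)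
qed simp_all

text \<open>All vertices of a class share one degree, so each class contributes a power. A big class
  sees the other big class and, through the \<open>of_bool\<close> term, the end of its path if that
  path is nonempty.\<close>

lemma degree_weight_class_graph:
  "degree_weight f (class_graph a s t b) =
    path_weight f a s * f (t + of_bool (0 < a)) ^ s *
    (f (s + of_bool (0 < b)) ^ t * path_weight f b t)"
proof -
  define D where "D i = (if i = 0 then 0 else class_size a s t (i - 1)) +
    (if i = a + b + 1 then 0 else class_size a s t (i + 1))" for i
  let ?h = "\<lambda>i. f (D i) ^ class_size a s t i"
  have "degree_weight f (class_graph a s t b) =
      (\<Prod>i\<in>{0..a + b + 1}. \<Prod>u\<in>vertex_class a s t i. f (degree (class_graph a s t b) u))"
    unfolding degree_weight_def class_graph_def fst_conv
    by (rule prod.UNION_disjoint) (auto simp: vertex_class_def)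
  also have "\<dots> = (\<Prod>i\<in>{0..a + b + 1}. ?h i)"
  proof (rule prod.cong[OF refl])
    fix i assume "i \<in> {0..a + b + 1}"
    then have "f (degree (class_graph a s t b) u) = f (D i)" if "u \<in> vertex_class a s t i" for u
      using that degree_class_graph[of i a b "snd u" s t]
      by (auto simp: vertex_class_def D_def)
    then show "(\<Prod>u\<in>vertex_class a s t i. f (degree (class_graph a s t b) u)) = ?h i"
      by (simp add: vertex_class_def)
  qed
  also have "{0..a + b + 1} = {..<(a + 2) + b}" by auto
  also have "(\<Prod>i\<in>\<dots>. ?h i) = (\<Prod>i<a + 2. ?h i) * (\<Prod>i<b. ?h (a + 2 + i))"
    by (induction b) (simp_all add: ac_simps)
  also have "(\<Prod>i<a + 2. ?h i) = (\<Prod>i<a. ?h i) * ?h a * ?h (a + 1)"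
    by (simp add: numeral_2_eq_2)
  also have "(\<Prod>i<a. ?h i) =
      (\<Prod>i<a. f ((if i = 0 then 0 else 1) + (if i + 1 = a then s else 1)))"
    by (rule prod.cong) (auto simp: D_def class_size_def)
  also have "(\<Prod>i<b. ?h (a + 2 + i)) =
      (\<Prod>i<b. f ((if i = 0 then t else 1) + (if i + 1 = b then 0 else 1)))"
    by (rule prod.cong) (auto simp: D_def class_size_def)
  finally show ?thesis
    unfolding path_weight_left path_weight_right
    by (auto simp: D_def class_size_def ac_simps)
qed

section \<open>The two indices as degree weights\<close>

lemma zagreb_prod1_eq_degree_weight: "zagreb_prod1 G = degree_weight (\<lambda>x. x\<^sup>2) G"
  by (simp add: zagreb_prod1_def degree_weight_def)

lemma zagreb_prod2_eq_degree_weight: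
  "simple_connected_graph G \<Longrightarrow> zagreb_prod2 G = degree_weight (\<lambda>x. x ^ x) G"
  by (simp add: zagreb_prod2_eq_prod_verts degree_weight_def)

text \<open>The domain starts at 1 because \<open>0 ^ 0 = 1 ^ 1\<close>.\<close>

lemma strict_mono_on_self_power: "strict_mono_on {1..} (\<lambda>x::nat. x ^ x)"
proof (rule strict_mono_onI)
  fix x y :: nat assume "x \<in> {1..}" "x < y"
  then have "x ^ x < y ^ x" by (intro power_strict_mono) auto
  also have "\<dots> \<le> y ^ y" using \<open>x < y\<close> by (intro power_increasing) auto
  finally show "x ^ x < y ^ y" .
qed

section \<open>Comparing the weights for consecutive values of \<open>d\<close>\<close>

context
  fixes f :: "nat \<Rightarrow> nat"
  assumes mono: "strict_mono_on {1..} f" and one: "f 1 = 1"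
begin

lemma weight_less: "1 \<le> x \<Longrightarrow> x < y \<Longrightarrow> f x < f y"
  using strict_mono_onD[OF mono, of x y] by simp

lemma weight_le: "1 \<le> x \<Longrightarrow> x \<le> y \<Longrightarrow> f x \<le> f y"
  using weight_less[of x y] by (cases "x = y") auto

lemma weight_pos: "1 \<le> x \<Longrightarrow> 0 < f x"
  using weight_less[of 1 x] one by (cases "x = 1") auto

text \<open>These are the comparisons for \<open>d\<close> = 2, 3, 4 and \<open>d\<close> \<ge> 5,
  new weight on the left and old on the right, with common powers of \<open>f 2\<close> already
  removed. The bound \<open>2 \<le> t\<close> keeps \<open>t - 1\<close> in the range where
  \<open>f\<close> is monotone.\<close>

lemma weight_step:
  assumes s: "1 \<le> s" and t: "2 \<le> t" "t = s \<or> t = s + 1"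
  shows weight_step_2_3:
      "f (t - 1) * f s * f (s + 1) ^ (t - 1) * f t ^ s < f t ^ (s + 1) * f (s + 1) ^ t" (is ?A)
    and weight_step_3_4:
      "f (t - 1) * f (s + 1) ^ t * f t ^ s < f s * f t * f (t + 1) ^ s * f (s + 1) ^ t" (is ?B)
    and weight_step_4_5:
      "f (s + 1) ^ t * f t ^ (s + 1) < f s * f (t + 1) ^ (s + 1) * f (s + 1) ^ t" (is ?C)
    and weight_step_ge_5:
      "f 2 * (f (s + 1) ^ t * f t ^ (s + 1)) < f (t + 1) ^ (s + 1) * f (s + 1) ^ (t + 1)" (is ?D)
proof -
  define p where "p = f (t - 1)"
  define q where "q = f t"
  define r where "r = f (s + 1)"
  define u where "u = f (t + 1)"
  define v where "v = f s"
  note defs = p_def q_def r_def u_def v_def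
  have pos: "0 < p" "0 < q" "0 < r" "0 < u" "0 < v"
    using s t by (auto simp: defs intro!: weight_pos)
  \<comment> \<open>These relations hold both for \<open>t = s\<close> and for
    \<open>t = s + 1\<close>, so the parity of the total size needs no further case split.\<close>
  have le: "p < q" "q < u" "q \<le> r" "p \<le> v" "v < r" "v \<le> q" "r \<le> u"
    using s t by (auto simp: defs intro!: weight_less weight_le)
  have f2: "f 2 \<le> r" "f 2 \<le> q"
    using s t by (auto simp: defs intro!: weight_le)
  obtain k where k: "t = Suc k" using t by (cases t) auto
  show ?A
  proof -
    have "p * v < q * r" using le pos by (intro mult_strict_mono) auto
    then have "p * v * (r ^ k * q ^ s) < q * r * (r ^ k * q ^ s)" using pos by simp
    then show ?thesis unfolding defs[symmetric] by (simp add: k ac_simps)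
  qed
  show ?B
  proof -
    have "p * q ^ s < v * q * u ^ s"
    proof -
      have "q ^ s < u ^ s" using le pos s by (intro power_strict_mono) auto
      moreover have "p \<le> v * q" using le pos
        by (metis le_trans mult_le_mono2 mult.right_neutral Suc_leI One_nat_def)
      ultimately show ?thesis using pos by (intro mult_le_less_imp_less) auto
    qed
    then have "p * q ^ s * r ^ t < v * q * u ^ s * r ^ t" using pos by simp
    then show ?thesis unfolding defs[symmetric] by (simp add: ac_simps)
  qed
  \<comment> \<open>The last two inequalities get their strictness from \<open>q < u\<close>; the
    remaining factors are compared weakly, by \<open>1 \<le> v\<close> and by
    \<open>f 2 \<le> r\<close>.\<close>
  have pw: "q ^ (s + 1) < u ^ (s + 1)" using le pos by (intro power_strict_mono) auto
  show ?C
  proof -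
    have "q ^ (s + 1) < v * u ^ (s + 1)" using pw pos
      by (metis less_le_trans mult_le_mono1 mult_1 Suc_leI One_nat_def)
    then have "r ^ t * q ^ (s + 1) < r ^ t * (v * u ^ (s + 1))" using pos by simp
    then show ?thesis unfolding defs[symmetric] by (simp add: ac_simps)
  qed
  show ?D
  proof -
    have "f 2 * q ^ (s + 1) < r * u ^ (s + 1)" using pw f2 pos
      by (intro mult_le_less_imp_less) (auto intro: weight_pos)
    then have "r ^ t * (f 2 * q ^ (s + 1)) < r ^ t * (r * u ^ (s + 1))" using pos by simp
    then show ?thesis unfolding defs[symmetric] by (simp add: ac_simps)
  qed
qed

text \<open>Once both paths have at least two vertices, their lengths enter only through the
  exponent of \<open>f 2\<close>, hence only through their sum. How the length is split is then
  irrelevant, and a step in \<open>d\<close> adds a single factor \<open>f 2\<close>.\<close>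

lemma degree_weight_step:
  assumes s: "1 \<le> s" and t: "2 \<le> t" "t = s \<or> t = s + 1"
    and ab: "(a, b, a', b') \<in> {(0, 1, 1, 1), (1, 1, 1, 2), (1, 2, 2, 2)} \<or>
      2 \<le> a \<and> 2 \<le> b \<and> 2 \<le> a' \<and> 2 \<le> b' \<and> a' + b' = a + b + 1"
  shows "degree_weight f (class_graph a' (t - 1) s b') < degree_weight f (class_graph a s t b)"
proof -
  have t1: "Suc (t - Suc 0) = t" using t by simp
  \<comment> \<open>The new first class gives \<open>f (s + 1) ^ (t - 1)\<close>; a right path with
    at least two vertices supplies the missing factor, as its attached vertex has degree
    \<open>s + 1\<close>.\<close>
  have tpow: "x ^ t = x * x ^ (t - Suc 0)" for x :: nat using t1 by (metis power_Suc)
  note simps = degree_weight_class_graph numeral_2_eq_2 one[simplified] t1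
  consider "a = 0" "b = 1" "a' = 1" "b' = 1" | "a = 1" "b = 1" "a' = 1" "b' = 2"
    | "a = 1" "b = 2" "a' = 2" "b' = 2"
    | "2 \<le> a" "2 \<le> b" "2 \<le> a'" "2 \<le> b'" "a' + b' = a + b + 1"
    using ab by auto
  then show ?thesis
  proof cases
    case 1
    then show ?thesis using weight_step_2_3[OF assms(1-3)] by (simp add: simps ac_simps)
  next
    case 2
    then show ?thesis using weight_step_3_4[OF assms(1-3)] by (simp add: simps tpow ac_simps)
  next
    case 3
    then show ?thesis using weight_step_4_5[OF assms(1-3)] by (simp add: simps tpow ac_simps)
  next
    case 4
    then obtain i j i' j' where *: "a = Suc (Suc i)" "b = Suc (Suc j)" "a' = Suc (Suc i')"
      "b' = Suc (Suc j')" by (metis add_2_eq_Suc le_Suc_ex)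
    with 4 have sum: "i' + j' = Suc (i + j)" by simp
    have new: "degree_weight f (class_graph a' (t - 1) s b') =
        f 2 ^ (i' + j') * (f (s + 1) ^ t * f t ^ (s + 1))"
      using * by (simp add: simps tpow power_add ac_simps)
    have old: "degree_weight f (class_graph a s t b) =
        f 2 ^ (i + j) * (f (t + 1) ^ (s + 1) * f (s + 1) ^ (t + 1))"
      using * by (simp add: simps power_add ac_simps)
    have "0 < f 2 ^ (i + j)" using weight_pos[of 2] by simp
    then show ?thesis using weight_step_ge_5[OF assms(1-3)] unfolding new old sum
      by (simp add: ac_simps)
  qed
qed

end

section \<open>From consecutive values to the whole interval\<close>

lemma strict_antimono_on_interval_natI:
  fixes g :: "nat \<Rightarrow> nat"
  assumes "\<And>d. m \<le> d \<Longrightarrow> Suc d \<le> n \<Longrightarrow> g (Suc d) < g d"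
  shows "strict_antimono_on {m..n} g"
proof (rule monotone_onI)
  fix x y assume "x \<in> {m..n}" "y \<in> {m..n}" "x < y"
  \<comment> \<open>The bounds are part of the induction claim because the transitivity case passes
    through an intermediate point, which must be shown to lie in the interval as well.\<close>
  have "m \<le> x \<longrightarrow> y \<le> n \<longrightarrow> g y < g x"
    using \<open>x < y\<close> by (induction rule: less_Suc_induct) (auto simp: assms intro: less_trans)
  then show "g y < g x" using \<open>x \<in> _\<close> \<open>y \<in> _\<close> by simp
qed

theorem theorem4p1:
  fixes n :: nat and a b :: "nat \<Rightarrow> nat" and G :: "nat \<Rightarrow> (nat \<times> nat) graph"
  assumes G: "\<And>d. d \<in> {2..n - 1} \<Longrightarrow>
      G d = class_graph (a d) ((n - d + 1) div 2) ((n - d + 1 + 1) div 2) (b d)"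
    and sum_ab: "\<And>d. d \<in> {2..n - 1} \<Longrightarrow> a d + b d = d - 1"
    and le_ab: "\<And>d. d \<in> {2..n - 1} \<Longrightarrow> a d \<le> b d"
    and ab2: "2 \<in> {2..n - 1} \<Longrightarrow> (a 2, b 2) = (0, 1)"
    and ab3: "3 \<in> {2..n - 1} \<Longrightarrow> (a 3, b 3) = (1, 1)"
    and ab4: "4 \<in> {2..n - 1} \<Longrightarrow> (a 4, b 4) = (1, 2)"
    and ab5: "5 \<in> {2..n - 1} \<Longrightarrow> (a 5, b 5) = (2, 2)"
    and ab6: "6 \<in> {2..n - 1} \<Longrightarrow> (a 6, b 6) = (2, 3)"
    and ab7: "\<And>d. d \<in> {2..n - 1} \<Longrightarrow> d \<ge> 7 \<Longrightarrow> a d \<ge> 3 \<and> b d \<ge> 3"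
  shows "strict_antimono_on {2..n - 1} (\<lambda>d. zagreb_prod1 (G d)) \<and>
         strict_antimono_on {2..n - 1} (\<lambda>d. zagreb_prod2 (G d))"
proof -
  \<comment> \<open>Here \<open>n - d + 1\<close> is at least 2. Nonempty classes make the graph
    connected, as required for rewriting the edge product as a vertex product.\<close>
  have G_pos: "0 < (n - d + 1) div 2 \<and> 0 < (n - d + 1 + 1) div 2" if "d \<in> {2..n - 1}" for d
    using that by auto
  have anti: "strict_antimono_on {2..n - 1} (\<lambda>d. degree_weight f (G d))"
    if f: "strict_mono_on {1..} f" "f 1 = 1" for f :: "nat \<Rightarrow> nat"
  proof (rule strict_antimono_on_interval_natI)
    fix d assume d: "2 \<le> d" "Suc d \<le> n - 1"
    define s where "s = (n - d + 1) div 2"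
    define t where "t = (n - d + 1 + 1) div 2"
    have mem: "d \<in> {2..n - 1}" "Suc d \<in> {2..n - 1}" using d by auto
    \<comment> \<open>Since \<open>Suc d\<close> is still admissible, \<open>n - d + 1\<close> is at
      least 3, which gives \<open>2 \<le> t\<close>.\<close>
    have st: "1 \<le> s" "2 \<le> t" "t = s \<or> t = s + 1"
      using d unfolding s_def t_def by presburger+
    have next_st: "(n - Suc d + 1) div 2 = t - 1" "(n - Suc d + 1 + 1) div 2 = s"
      using d unfolding s_def t_def by presburger+
    \<comment> \<open>From 5 on both paths have at least two vertices, so the uniform case of the
      step applies to \<open>d\<close> and \<open>Suc d\<close>.\<close>
    have ge5: "2 \<le> a e \<and> 2 \<le> b e" if "5 \<le> e" "e \<in> {2..n - 1}" for e
    proof -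
      consider "e = 5" | "e = 6" | "7 \<le> e" using \<open>5 \<le> e\<close> by linarith
      then show ?thesis
        using ab5 ab6 ab7[of e] that by cases auto
    qed
    have ab: "(a d, b d, a (Suc d), b (Suc d)) \<in> {(0, 1, 1, 1), (1, 1, 1, 2), (1, 2, 2, 2)} \<or>
      2 \<le> a d \<and> 2 \<le> b d \<and> 2 \<le> a (Suc d) \<and> 2 \<le> b (Suc d) \<and>
      a (Suc d) + b (Suc d) = a d + b d + 1"
    proof -
      consider "d = 2" | "d = 3" | "d = 4" | "5 \<le> d" using d by linarith
      then show ?thesis
      proof cases
        case 4
        then show ?thesis using ge5[of d] ge5[of "Suc d"] sum_ab[of d] sum_ab[of "Suc d"] mem
          by auto
      qed (use ab2 ab3 ab4 ab5 mem in auto)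
    qed
    show "degree_weight f (G (Suc d)) < degree_weight f (G d)"
      using degree_weight_step[OF f st ab]
      unfolding G[OF mem(1)] G[OF mem(2)] next_st s_def[symmetric] t_def[symmetric] .
  qed
  have "strict_mono_on {1..} (\<lambda>x::nat. x\<^sup>2)"
    by (auto intro!: strict_mono_onI power_strict_mono)
  from anti[OF this] have "strict_antimono_on {2..n - 1} (\<lambda>d. zagreb_prod1 (G d))"
    by (simp add: zagreb_prod1_eq_degree_weight)
  moreover have "zagreb_prod2 (G d) = degree_weight (\<lambda>x. x ^ x) (G d)" if "d \<in> {2..n - 1}" for d
    using simple_connected_class_graph G_pos[OF that] G[OF that]
    by (intro zagreb_prod2_eq_degree_weight) simp
  with anti[OF strict_mono_on_self_power]
  have "strict_antimono_on {2..n - 1} (\<lambda>d. zagreb_prod2 (G d))"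
    by (simp add: monotone_on_def)
  ultimately show ?thesis ..
qed

end
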